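(* For every $\theta>0$ and $h\in\mathcal{H}_{1,1}$, there exists a solution $f\in\mathcal{H}_{\theta,\theta/2}$ to the equation $$\frac{x}{\theta}f'(x)+f(x)-f(x+1)=h(x)-E[h(D_\theta)],\qquad x\ge0,$$ such that $$\sup_{x\in(0,\infty)}|f'(x)|\le\theta\qquad\text{and}\qquad\sup_{x\in(0,\infty)}|f''(x)|\le\frac{\theta}{2}.$$
   Context: $D_\theta$ has the generalized Dickman distribution $\mathcal{D}_\theta$, the unique law of a non-negative random variable $W$ satisfying $W=_dU^{1/\theta}(W+1)$, where $U\sim\mathcal{U}[0,1]$ is independent of $W$ and $=_d$ is equality in distribution. $\mathrm{Lip}_\alpha$ is the set of real-valued functions $h$ with $|h(x)-h(y)|\le\alpha|x-y|$ for all $x,y$ in the domain. For $\alpha,\beta\ge0$, $\mathcal{H}_{\alpha,\beta}$ is the set of differentiable functions $h:[0,\infty)\to\mathbb{R}$ (one-sided derivative at $0$) with $h\in\mathrm{Lip}_\alpha$ and $h'\in\mathrm{Lip}_\beta$. The bound on $f''$ includes the assertion that $f$ is twice differentiable on $(0,\infty)$. *)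

theory Defs
  imports "HOL-Probability.Probability"
begin

(* The distributional equation W =_d U powr (1/theta) * (W + 1), stated for the law of W:
   on the product measure, the two coordinates are independent with laws mu (for W) and
   U[0,1] (for U). *)
definition is_dickman_law :: "real \<Rightarrow> real measure \<Rightarrow> bool" where
  "is_dickman_law \<theta> \<mu> \<longleftrightarrow>
     real_distribution \<mu> \<and> (AE w in \<mu>. 0 \<le> w) \<and>
     \<mu> = distr (\<mu> \<Otimes>\<^sub>M uniform_measure lborel {0..1}) borel
            (\<lambda>(w, u). u powr (1 / \<theta>) * (w + 1))"

definition dickman :: "real \<Rightarrow> real measure" where
  "dickman \<theta> = (THE \<mu>. is_dickman_law \<theta> \<mu>)"

(* Functions on the half-line [0,\<infinity>) are represented by functions real \<Rightarrow> real of which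
   only the values on {0..} are used. The derivative is taken within {0..}: one-sided at 0,
   two-sided at every x > 0. *)
definition hderiv :: "(real \<Rightarrow> real) \<Rightarrow> real \<Rightarrow> real" where
  "hderiv f x = vector_derivative f (at x within {0..})"

lemma hderiv_eqI:
  assumes "(f has_real_derivative D) (at x within {0..})" "0 \<le> x"
  shows "hderiv f x = D"
proof -
  have "at x within {0..} \<noteq> bot"
  proof -
    have "x islimpt {x..x + 1}" by (simp add: islimpt_Icc)
    then have "x islimpt {0..}" by (rule islimpt_subset) (use assms(2) in auto)
    then show ?thesis by (simp add: trivial_limit_within)
  qed
  then show ?thesis
    unfolding hderiv_def using assms(1)
    by (intro vector_derivative_within) (auto simp: has_real_derivative_iff_has_vector_derivative)
qed

definition H_class :: "real \<Rightarrow> real \<Rightarrow> (real \<Rightarrow> real) set" where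
  "H_class \<alpha> \<beta> = {h. h differentiable_on {0..} \<and>
      \<alpha>-lipschitz_on {0..} h \<and> \<beta>-lipschitz_on {0..} (hderiv h)}"

(* E[h(D_theta)]. Since h is only given on {0..}, where the law is concentrated, the
   integral must be restricted to {0..}: h may be non-measurable on the negative reals. *)
definition dickman_expectation :: "real \<Rightarrow> (real \<Rightarrow> real) \<Rightarrow> real" where
  "dickman_expectation \<theta> h = (LINT x:{0..}|dickman \<theta>. h x)"

end

theory Submission
  imports Defs
begin

text \<open>Let \<open>U\<close> be uniform on the unit interval. Averaging \<open>g\<close> over the dilations \<open>U powr (1 / \<theta>) * x\<close> of its
argument gives a function \<open>f\<close> with \<open>x / \<theta> * f' x + f x = g x\<close>, and \<open>f (x + 1)\<close> is then
\<open>P g x\<close>, where \<open>P\<close> is the transition operator of the Markov chain \<open>x \<mapsto> U powr (1 / \<theta>) * (x + 1)\<close>. The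
Dickman law is the stationary law of this chain, and the equation asks for \<open>g - P g = h - c\<close> with \<open>c\<close> the
mean of \<open>h\<close> under it. So \<open>g\<close> should be the sum over \<open>n\<close> of \<open>P\<^sup>n h - c\<close>, and \<open>f\<close> the sum of the averages of
these terms (\<open>Stein_equation_C11\<close>).

Each averaging multiplies the bound on the first derivative by the mean \<open>\<theta> / (\<theta> + 1)\<close> of
\<open>U powr (1 / \<theta>)\<close> and the Lipschitz constant of the derivative by the mean \<open>\<theta> / (\<theta> + 2)\<close> of
\<open>U powr (2 / \<theta>)\<close> (\<open>C11_dilation_average\<close>). Hence the iterates flatten at a geometric rate, and together
with stationarity this makes them converge to \<open>c\<close> summably fast (\<open>transition_funpow_mixing\<close>); the
two geometric series have the sums \<open>\<theta>\<close> and \<open>\<theta> / 2\<close>, which are the constants of the theorem. The second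
derivative exists because for \<open>x > 0\<close> the equation can be solved for \<open>f' x\<close>, and it is bounded
by the Lipschitz constant of \<open>f'\<close>.

The constant \<open>c\<close> is an expectation under a law defined by a definite description, so existence and
uniqueness of that law are part of the proof. The law is realised as a random series over an
infinite sequence of independent uniform variables, which also shows that it has a mean
(\<open>dickman_law_exists\<close>). Uniqueness follows from the contraction once more: for bounded smooth
test functions, in particular sine and cosine, the iterates \<open>P\<^sup>n h\<close> tend to a constant, which is
therefore the mean under every stationary law, and characteristic functions determine laws
(\<open>dickman_law_unique\<close>).

The function \<open>h\<close> is first extended to the whole real line, so that derivatives are two-sided
throughout the analysis.\<close>

section \<open>Functions with bounded Lipschitz derivative\<close>

text \<open>The class of \<open>C\<^sup>1\<close> functions on the whole line with bounded, Lipschitz derivative. The derivative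
is an argument of its own because the averaging operator below acts on a function and on its
derivative by two different formulas, which are iterated side by side.\<close>

definition C11 :: "real \<Rightarrow> real \<Rightarrow> (real \<Rightarrow> real) \<Rightarrow> (real \<Rightarrow> real) \<Rightarrow> bool" where
  "C11 a b g g' \<longleftrightarrow>
     (\<forall>x. (g has_real_derivative g' x) (at x)) \<and> (\<forall>x. \<bar>g' x\<bar> \<le> a) \<and> b-lipschitz_on UNIV g'"

lemma C11D:
  assumes "C11 a b g g'"
  shows "(g has_real_derivative g' x) (at x)" "\<bar>g' x\<bar> \<le> a"
    "b-lipschitz_on UNIV g'" "continuous_on S g" "continuous_on S g'"
proof -
  show d: "(g has_real_derivative g' x) (at x)" for x
    using assms by (auto simp: C11_def)
  show "\<bar>g' x\<bar> \<le> a" "b-lipschitz_on UNIV g'"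
    using assms by (auto simp: C11_def)
  then show "continuous_on S g'"
    using lipschitz_on_continuous_on continuous_on_subset by blast
  show "continuous_on S g"
    using d by (meson DERIV_isCont continuous_at_imp_continuous_on)
qed

lemma C11_lipschitz:
  assumes "C11 a b g g'"
  shows "\<bar>g x - g y\<bar> \<le> a * \<bar>x - y\<bar>"
  using field_differentiable_bound[of UNIV g g' a x y] C11D(1,2)[OF assms]
  by auto

text \<open>These are the test functions from which a characteristic function is built; belonging to the class,
they are subject to the same contraction argument as \<open>h\<close>, and this identifies the Dickman law.\<close>

lemma C11_sin_cos:
  "C11 \<bar>t\<bar> (t\<^sup>2) (\<lambda>x. sin (t * x)) (\<lambda>x. t * cos (t * x))"
  "C11 \<bar>t\<bar> (t\<^sup>2) (\<lambda>x. cos (t * x)) (\<lambda>x. - t * sin (t * x))"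
proof -
  have "norm (sin x - sin y) \<le> 1 * norm (x - y)" for x y :: real
    by (rule field_differentiable_bound[of UNIV sin cos]) (auto intro!: derivative_eq_intros)
  moreover have "norm (cos x - cos y) \<le> 1 * norm (x - y)" for x y :: real
    by (rule field_differentiable_bound[of UNIV cos "\<lambda>x. - sin x"]) (auto intro!: derivative_eq_intros)
  ultimately have lip: "\<bar>sin x - sin y\<bar> \<le> \<bar>x - y\<bar>" "\<bar>cos x - cos y\<bar> \<le> \<bar>x - y\<bar>" for x y :: real
    by simp_all
  have "\<bar>t * cos (t * x) - t * cos (t * y)\<bar> \<le> t\<^sup>2 * \<bar>x - y\<bar>"
    "\<bar>t * sin (t * x) - t * sin (t * y)\<bar> \<le> t\<^sup>2 * \<bar>x - y\<bar>" for x y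
    using mult_left_mono[OF lip(1)[of "t * x" "t * y"], of "\<bar>t\<bar>"]
      mult_left_mono[OF lip(2)[of "t * x" "t * y"], of "\<bar>t\<bar>"]
    by (simp_all add: power2_eq_square abs_mult flip: right_diff_distrib mult.assoc)
  then show "C11 \<bar>t\<bar> (t\<^sup>2) (\<lambda>x. sin (t * x)) (\<lambda>x. t * cos (t * x))"
    "C11 \<bar>t\<bar> (t\<^sup>2) (\<lambda>x. cos (t * x)) (\<lambda>x. - t * sin (t * x))"
    unfolding C11_def
    by (auto intro!: derivative_eq_intros lipschitz_onI mult_left_le
        simp: abs_mult dist_real_def abs_minus_commute)
qed

lemma C11_shift:
  assumes "C11 a b g g'"
  shows "C11 a b (\<lambda>x. g (x + c)) (\<lambda>x. g' (x + c))"
  unfolding C11_def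
proof (intro conjI allI)
  show "((\<lambda>x. g (x + c)) has_real_derivative g' (x + c)) (at x)" for x
    using C11D(1)[OF assms, of "x + c"] by (simp add: DERIV_shift)
  show "\<bar>g' (x + c)\<bar> \<le> a" for x
    by (rule C11D(2)[OF assms])
  show "b-lipschitz_on UNIV (\<lambda>x. g' (x + c))"
  proof (rule lipschitz_onI)
    show "dist (g' (x + c)) (g' (y + c)) \<le> b * dist x y" for x y
      using lipschitz_onD[OF C11D(3)[OF assms], of "x + c" "y + c"] by (simp add: dist_real_def)
  qed (use C11D(3)[OF assms] lipschitz_on_nonneg in auto)
qed

section \<open>Averaging over random dilations\<close>

text \<open>The expectation of \<open>g (U powr (1 / \<theta>) * x)\<close> for \<open>U\<close> uniform on the unit interval. In terms of
\<open>v = u powr (1 / \<theta>) * x\<close> it is, for \<open>x > 0\<close>, the mean of \<open>g\<close> on \<open>{0..x}\<close> with weight proportional to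
\<open>v powr (\<theta> - 1)\<close>; the form chosen here makes sense at \<open>x = 0\<close> and for \<open>x < 0\<close> as well.\<close>

definition dilation_average :: "real \<Rightarrow> (real \<Rightarrow> real) \<Rightarrow> real \<Rightarrow> real" where
  "dilation_average \<theta> g x = integral {0..1} (\<lambda>u. g (u powr (1 / \<theta>) * x))"

definition dilation_average_deriv :: "real \<Rightarrow> (real \<Rightarrow> real) \<Rightarrow> real \<Rightarrow> real" where
  "dilation_average_deriv \<theta> g' x = integral {0..1} (\<lambda>u. u powr (1 / \<theta>) * g' (u powr (1 / \<theta>) * x))"

text \<open>The Markov operator of the chain that moves from \<open>x\<close> to \<open>U powr (1 / \<theta>) * (x + 1)\<close>, whose stationary
law is the Dickman law.\<close>

definition transition :: "real \<Rightarrow> (real \<Rightarrow> real) \<Rightarrow> real \<Rightarrow> real" where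
  "transition \<theta> g x = dilation_average \<theta> g (x + 1)"

definition transition_deriv :: "real \<Rightarrow> (real \<Rightarrow> real) \<Rightarrow> real \<Rightarrow> real" where
  "transition_deriv \<theta> g' x = dilation_average_deriv \<theta> g' (x + 1)"

lemma continuous_on_powr_unit [continuous_intros]:
  "a > 0 \<Longrightarrow> continuous_on {0..1::real} (\<lambda>u. u powr a)"
  by (intro continuous_on_powr' continuous_intros) auto

lemma integral_powr_unit:
  assumes "a > 0"
  shows "integral {0..1} (\<lambda>u::real. u powr a) = 1 / (a + 1)"
  using has_integral_powr_from_0[of a 1] assms by (auto simp: integral_unique)

context
  fixes \<theta> :: real
  assumes \<theta>: "\<theta> > 0"
begin

lemma continuous_on_dilation:
  assumes "continuous_on UNIV g"
  shows "continuous_on {0..1} (\<lambda>u::real. g (u powr (1 / \<theta>) * x))"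
  by (rule continuous_on_compose2[OF assms])
     (use \<theta> in \<open>auto intro!: continuous_intros\<close>)

text \<open>Differentiating under the integral brings down one factor \<open>u powr (1 / \<theta>)\<close>, whose mean is
\<open>\<theta> / (\<theta> + 1)\<close>. In the Lipschitz estimate for the derivative the argument contributes a second such
factor, and the mean of \<open>u powr (2 / \<theta>)\<close> is \<open>\<theta> / (\<theta> + 2)\<close>.\<close>

lemma C11_dilation_average:
  assumes g: "C11 a b g g'"
  shows "C11 (\<theta> / (\<theta> + 1) * a) (\<theta> / (\<theta> + 2) * b)
    (dilation_average \<theta> g) (dilation_average_deriv \<theta> g')"
  unfolding C11_def
proof (intro conjI allI)
  note cg = C11D(4)[OF g, of UNIV] and cg' = C11D(5)[OF g, of UNIV]
  have "continuous_on {0..1} (\<lambda>u. u powr (1 / \<theta>) * g' (u powr (1 / \<theta>) * x))" for x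
    using \<theta> by (intro continuous_intros continuous_on_dilation[OF cg']) auto
  then have int: "(\<lambda>u. u powr (1 / \<theta>) * g' (u powr (1 / \<theta>) * x)) integrable_on {0..1}" for x
    by (rule integrable_continuous_real)
  have intp: "(\<lambda>u::real. u powr e) integrable_on {0..1}" if "e > 0" for e
    using that by (intro integrable_continuous_real continuous_intros) auto
  show "(dilation_average \<theta> g has_real_derivative dilation_average_deriv \<theta> g' x) (at x)" for x
  proof -
    have "((\<lambda>x. integral (cbox 0 1) (\<lambda>u. g (u powr (1 / \<theta>) * x))) has_field_derivative
        integral (cbox 0 1) (\<lambda>u. u powr (1 / \<theta>) * g' (u powr (1 / \<theta>) * x))) (at x within UNIV)"
    proof (rule leibniz_rule_field_derivative)
      show "((\<lambda>x. g (t powr (1 / \<theta>) * x)) has_real_derivative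
          t powr (1 / \<theta>) * g' (t powr (1 / \<theta>) * x)) (at x within UNIV)" for x t
        by (rule DERIV_cong, rule DERIV_chain2[OF C11D(1)[OF g]])
           (auto intro!: derivative_eq_intros)
      show "(\<lambda>u. g (u powr (1 / \<theta>) * x)) integrable_on cbox 0 1" for x
        using continuous_on_dilation[OF cg] by (simp add: integrable_continuous_real)
      have p: "continuous_on (UNIV \<times> {0..1}) (\<lambda>z::real \<times> real. snd z powr (1 / \<theta>))"
        using \<theta> by (intro continuous_on_powr' continuous_intros) auto
      have "continuous_on (UNIV \<times> {0..1})
         (\<lambda>z. snd z powr (1 / \<theta>) * g' (snd z powr (1 / \<theta>) * fst z))"
        by (intro continuous_intros p continuous_on_compose2[OF cg']) auto
      then show "continuous_on (UNIV \<times> cbox 0 1)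
         (\<lambda>(x, t). t powr (1 / \<theta>) * g' (t powr (1 / \<theta>) * x))"
        by (simp add: case_prod_unfold)
    qed auto
    then show ?thesis
      by (simp add: dilation_average_def[abs_def] dilation_average_deriv_def)
  qed
  show "\<bar>dilation_average_deriv \<theta> g' x\<bar> \<le> \<theta> / (\<theta> + 1) * a" for x
  proof -
    have "\<bar>dilation_average_deriv \<theta> g' x\<bar> \<le> integral {0..1} (\<lambda>u. u powr (1 / \<theta>) * a)"
      unfolding dilation_average_deriv_def real_norm_def[symmetric]
      using \<theta> C11D(2)[OF g] int
      by (intro integral_norm_bound_integral integrable_on_mult_left intp)
         (auto simp: abs_mult intro!: mult_left_mono)
    also have "\<dots> = \<theta> / (\<theta> + 1) * a"
      using \<theta> by (simp add: integral_powr_unit field_simps)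
    finally show ?thesis .
  qed
  show "(\<theta> / (\<theta> + 2) * b)-lipschitz_on UNIV (dilation_average_deriv \<theta> g')"
  proof (rule lipschitz_onI)
    have b: "b \<ge> 0" using C11D(3)[OF g] lipschitz_on_nonneg by auto
    then show "0 \<le> \<theta> / (\<theta> + 2) * b" using \<theta> by simp
    fix x y :: real
    have pt: "\<bar>u powr (1 / \<theta>) * g' (u powr (1 / \<theta>) * x) - u powr (1 / \<theta>) * g' (u powr (1 / \<theta>) * y)\<bar>
        \<le> u powr (2 / \<theta>) * (b * \<bar>x - y\<bar>)" for u
    proof -
      have "\<bar>u powr (1 / \<theta>) * g' (u powr (1 / \<theta>) * x) - u powr (1 / \<theta>) * g' (u powr (1 / \<theta>) * y)\<bar>
         = u powr (1 / \<theta>) * \<bar>g' (u powr (1 / \<theta>) * x) - g' (u powr (1 / \<theta>) * y)\<bar>"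
        by (simp add: abs_mult flip: right_diff_distrib)
      also have "\<dots> \<le> u powr (1 / \<theta>) * (b * \<bar>u powr (1 / \<theta>) * x - u powr (1 / \<theta>) * y\<bar>)"
        using lipschitz_onD[OF C11D(3)[OF g]] by (intro mult_left_mono) (auto simp: dist_real_def)
      also have "\<dots> = (u powr (1 / \<theta>) * u powr (1 / \<theta>)) * (b * \<bar>x - y\<bar>)"
        by (simp add: abs_mult flip: right_diff_distrib)
      also have "u powr (1 / \<theta>) * u powr (1 / \<theta>) = u powr (2 / \<theta>)"
        by (simp flip: powr_add)
      finally show ?thesis .
    qed
    have "\<bar>dilation_average_deriv \<theta> g' x - dilation_average_deriv \<theta> g' y\<bar>
       = \<bar>integral {0..1} (\<lambda>u. u powr (1 / \<theta>) * g' (u powr (1 / \<theta>) * x) - u powr (1 / \<theta>) * g' (u powr (1 / \<theta>) * y))\<bar>"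
      unfolding dilation_average_deriv_def by (subst integral_diff) (auto intro: int)
    also have "\<dots> \<le> integral {0..1} (\<lambda>u. u powr (2 / \<theta>) * (b * \<bar>x - y\<bar>))"
      unfolding real_norm_def[symmetric]
      using \<theta> int pt
      by (intro integral_norm_bound_integral integrable_on_mult_left intp integrable_diff) auto
    also have "\<dots> = \<theta> / (\<theta> + 2) * b * \<bar>x - y\<bar>"
      using \<theta> by (simp add: integral_powr_unit field_simps)
    finally show "dist (dilation_average_deriv \<theta> g' x) (dilation_average_deriv \<theta> g' y)
        \<le> \<theta> / (\<theta> + 2) * b * dist x y"
      by (simp add: dist_real_def)
  qed
qed

text \<open>Averaging inverts the first-order part of the equation: the integrand of the left-hand side is
the \<open>u\<close>-derivative of \<open>u * g (u powr (1 / \<theta>) * x)\<close>.\<close>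

lemma dilation_average_ode:
  assumes g: "C11 a b g g'"
  shows "x / \<theta> * dilation_average_deriv \<theta> g' x + dilation_average \<theta> g x = g x"
proof -
  note cg = C11D(4)[OF g, of UNIV] and cg' = C11D(5)[OF g, of UNIV]
  let ?s = "\<lambda>u::real. u powr (1 / \<theta>)"
  have "((\<lambda>u. g (?s u * x) + x / \<theta> * (?s u * g' (?s u * x))) has_integral
      1 * g (?s 1 * x) - 0 * g (?s 0 * x)) {0..1}"
  proof (rule fundamental_theorem_of_calculus_interior)
    show "continuous_on {0..1} (\<lambda>u. u * g (?s u * x))"
      by (intro continuous_intros continuous_on_dilation[OF cg])
    show "((\<lambda>u. u * g (?s u * x)) has_vector_derivative
        g (?s u * x) + x / \<theta> * (?s u * g' (?s u * x))) (at u)" if "u \<in> {0<..<1}" for u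
    proof -
      have u: "u > 0" using that by simp
      have "((\<lambda>u. u * g (?s u * x)) has_real_derivative
         1 * g (?s u * x) + (g' (?s u * x) * ((1 / \<theta> * u powr (1 / \<theta> - 1)) * x)) * u) (at u)"
        by (intro DERIV_mult DERIV_ident DERIV_chain2[OF C11D(1)[OF g]] DERIV_cmult_right
            has_real_derivative_powr u)
      moreover have "1 * g (?s u * x) + (g' (?s u * x) * ((1 / \<theta> * u powr (1 / \<theta> - 1)) * x)) * u
          = g (?s u * x) + x / \<theta> * ((u powr (1 / \<theta> - 1) * u) * g' (?s u * x))"
        by (simp add: algebra_simps)
      moreover have "u powr (1 / \<theta> - 1) * u = ?s u"
        using u by (simp add: powr_diff)
      ultimately show ?thesis
        by (simp only: has_real_derivative_iff_has_vector_derivative)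
    qed
  qed auto
  moreover have "((\<lambda>u. g (?s u * x) + x / \<theta> * (?s u * g' (?s u * x))) has_integral
      dilation_average \<theta> g x + x / \<theta> * dilation_average_deriv \<theta> g' x) {0..1}"
    unfolding dilation_average_def dilation_average_deriv_def using \<theta>
    by (intro has_integral_add has_integral_mult_right integrable_integral
        integrable_continuous_real continuous_on_dilation[OF cg] continuous_intros
        continuous_on_dilation[OF cg']) auto
  ultimately have "1 * g (?s 1 * x) - 0 * g (?s 0 * x)
      = dilation_average \<theta> g x + x / \<theta> * dilation_average_deriv \<theta> g' x"
    by (rule has_integral_unique)
  then show ?thesis
    by simp
qed

lemma C11_transition_funpow:
  assumes "C11 a b h h'"
  shows "C11 ((\<theta> / (\<theta> + 1)) ^ n * a) ((\<theta> / (\<theta> + 2)) ^ n * b)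
    ((transition \<theta> ^^ n) h) ((transition_deriv \<theta> ^^ n) h')"
proof (induction n)
  case (Suc n)
  from C11_shift[OF C11_dilation_average[OF Suc], of 1] show ?case
    by (simp add: transition_def[abs_def] transition_deriv_def[abs_def] mult_ac)
qed (use assms in simp)

section \<open>The solution as a telescoping series\<close>

text \<open>The solution is the sum of the averages of \<open>P\<^sup>n h - c\<close>, where \<open>P\<close> is the transition operator. The
\<open>n\<close>-th summand turns the left-hand side of the equation into \<open>P\<^sup>n h - P\<^sup>n\<^sup>+\<^sup>1 h\<close>, because evaluating
an average at \<open>x + 1\<close> is applying \<open>P\<close>; so the sum telescopes. The constants are those of geometric
series starting with their first power: \<open>\<rho> / (1 - \<rho>) = \<theta>\<close> and \<open>\<kappa> / (1 - \<kappa>) = \<theta> / 2\<close>.\<close>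

lemma Stein_equation_C11:
  assumes h: "C11 1 1 h h'"
    and c: "\<And>x. summable (\<lambda>n. (transition \<theta> ^^ n) h x - c)"
      "\<And>x. (\<lambda>n. (transition \<theta> ^^ n) h x) \<longlonglongrightarrow> c"
  obtains f f' where "C11 \<theta> (\<theta> / 2) f f'"
    "\<And>x. x / \<theta> * f' x + f x - f (x + 1) = h x - c"
proof -
  define G where "G n = (transition \<theta> ^^ n) h" for n
  define G' where "G' n = (transition_deriv \<theta> ^^ n) h'" for n
  define F where "F n x = dilation_average \<theta> (G n) x - c" for n x
  define F' where "F' n = dilation_average_deriv \<theta> (G' n)" for n
  define f where "f x = (\<Sum>n. F n x)" for x
  define f' where "f' x = (\<Sum>n. F' n x)" for x
  define \<rho> where "\<rho> = \<theta> / (\<theta> + 1)"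
  define \<kappa> where "\<kappa> = \<theta> / (\<theta> + 2)"
  have \<rho>: "0 \<le> \<rho>" "\<rho> < 1" and \<kappa>: "0 \<le> \<kappa>" "\<kappa> < 1"
    using \<theta> by (auto simp: \<rho>_def \<kappa>_def)
  have G: "C11 (\<rho> ^ n) (\<kappa> ^ n) (G n) (G' n)" for n
    using C11_transition_funpow[OF h, of n] by (simp add: G_def G'_def \<rho>_def \<kappa>_def)
  have FG: "C11 (\<rho> ^ Suc n) (\<kappa> ^ Suc n) (dilation_average \<theta> (G n)) (F' n)" for n
    using C11_dilation_average[OF G[of n]] by (simp add: F'_def \<rho>_def \<kappa>_def)
  have F_succ: "F n (x + 1) = G (Suc n) x - c" for n x
    by (simp add: F_def G_def transition_def)
  \<comment> \<open>An average at \<open>x\<close> is a transition from \<open>x - 1\<close>, possibly negative: one reason to work on the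
     whole line.\<close>
  have sumF: "summable (\<lambda>n. F n x)" for x
  proof -
    have "summable (\<lambda>n. G (Suc n) (x - 1) - c)"
      using c(1)[of "x - 1"] unfolding G_def by (subst summable_Suc_iff)
    then show ?thesis
      using F_succ[of _ "x - 1"] by simp
  qed
  have geo: "(\<lambda>n. \<rho> ^ Suc n) sums \<theta>" "(\<lambda>n. \<kappa> ^ Suc n) sums (\<theta> / 2)"
  proof -
    have geometric: "(\<lambda>n. r ^ Suc n) sums (r / (1 - r))" if "0 \<le> r" "r < 1" for r :: real
      using that sums_mult[OF geometric_sums[of r], of r] by simp
    have "\<rho> / (1 - \<rho>) = \<theta>" "\<kappa> / (1 - \<kappa>) = \<theta> / 2"
      using \<theta> by (simp_all add: \<rho>_def \<kappa>_def divide_simps)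
    then show "(\<lambda>n. \<rho> ^ Suc n) sums \<theta>" "(\<lambda>n. \<kappa> ^ Suc n) sums (\<theta> / 2)"
      using geometric[OF \<rho>] geometric[OF \<kappa>] by metis+
  qed
  have F'_bound: "\<bar>F' n x\<bar> \<le> \<rho> ^ Suc n" for n x
    by (rule C11D(2)[OF FG])
  have sumF': "summable (\<lambda>n. F' n x)" for x
    using F'_bound by (intro summable_comparison_test'[OF sums_summable[OF geo(1)], of 0]) auto
  have deriv: "(f has_real_derivative f' x) (at x)" for x
    unfolding f_def[abs_def] f'_def
  proof (rule has_field_derivative_series'(2)[of UNIV _ _ 0])
    show "(F n has_real_derivative F' n x) (at x within UNIV)" for n x
      unfolding F_def[abs_def] using C11D(1)[OF FG[of n], of x]
      by (auto intro!: derivative_eq_intros)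
    show "uniformly_convergent_on UNIV (\<lambda>n x. \<Sum>i<n. F' i x)"
    proof (rule Weierstrass_m_test')
      show "norm (F' n x) \<le> \<rho> ^ Suc n" for n x
        using F'_bound[of n x] by simp
    qed (rule sums_summable[OF geo(1)])
  qed (use sumF in auto)
  have "C11 \<theta> (\<theta> / 2) f f'"
    unfolding C11_def
  proof (intro conjI allI)
    show "\<bar>f' x\<bar> \<le> \<theta>" for x
    proof -
      have "norm (f' x) \<le> (\<Sum>n. \<rho> ^ Suc n)"
        unfolding f'_def using F'_bound sums_summable[OF geo(1)]
        by (intro norm_suminf_le) auto
      then show ?thesis using sums_unique[OF geo(1)] by simp
    qed
    show "(\<theta> / 2)-lipschitz_on UNIV f'"
    proof (rule lipschitz_onI)
      fix x y :: real
      have "norm (\<Sum>n. F' n x - F' n y) \<le> (\<Sum>n. \<kappa> ^ Suc n * \<bar>x - y\<bar>)"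
      proof (rule norm_suminf_le)
        show "summable (\<lambda>n. \<kappa> ^ Suc n * \<bar>x - y\<bar>)"
          by (intro summable_mult2 sums_summable[OF geo(2)])
        show "norm (F' n x - F' n y) \<le> \<kappa> ^ Suc n * \<bar>x - y\<bar>" for n
          using lipschitz_onD[OF C11D(3)[OF FG[of n]], of x y] by (simp add: dist_real_def)
      qed
      also have "\<dots> = \<theta> / 2 * \<bar>x - y\<bar>"
        by (rule sums_unique[symmetric, OF sums_mult2[OF geo(2)]])
      finally show "dist (f' x) (f' y) \<le> \<theta> / 2 * dist x y"
        using suminf_diff[OF sumF' sumF', of x y] by (simp add: f'_def dist_real_def)
    qed (use \<theta> in simp)
  qed (rule deriv)
  moreover have "x / \<theta> * f' x + f x - f (x + 1) = h x - c" for x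
  proof -
    have tele: "(\<lambda>n. G n x - G (Suc n) x) sums (G 0 x - c)"
      using c(2)[of x] unfolding G_def by (rule telescope_sums')
    have "(\<lambda>n. x / \<theta> * F' n x + F n x - F n (x + 1)) sums (x / \<theta> * f' x + f x - f (x + 1))"
      unfolding f_def f'_def
      by (intro sums_add sums_diff sums_mult summable_sums sumF sumF')
    also have "(\<lambda>n. x / \<theta> * F' n x + F n x - F n (x + 1)) = (\<lambda>n. G n x - G (Suc n) x)"
    proof
      fix n
      show "x / \<theta> * F' n x + F n x - F n (x + 1) = G n x - G (Suc n) x"
        using dilation_average_ode[OF G[of n], of x] F_succ[of n x] by (simp add: F_def F'_def)
    qed
    finally have "x / \<theta> * f' x + f x - f (x + 1) = G 0 x - c"
      using tele sums_unique2 by blast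
    then show ?thesis by (simp add: G_def)
  qed
  ultimately show ?thesis by (rule that)
qed

end

section \<open>Stationarity and uniqueness of the Dickman law\<close>

abbreviation unit_uniform :: "real measure" where
  "unit_uniform \<equiv> uniform_measure lborel {0..1}"

lemma prob_space_unit_uniform: "prob_space unit_uniform"
  by (intro prob_space_uniform_measure) auto

lemma integral_unit_uniform:
  fixes \<phi> :: "real \<Rightarrow> real"
  assumes "\<phi> \<in> borel_measurable borel" "continuous_on {0..1} \<phi>"
  shows "(LINT u|unit_uniform. \<phi> u) = integral {0..1} \<phi>"
proof -
  have "unit_uniform = density lborel (\<lambda>x. ennreal (indicator {0..1} x))"
    unfolding uniform_measure_def
    by (intro density_cong) (auto split: split_indicator simp: divide_ennreal_def)
  then have "(LINT u|unit_uniform. \<phi> u) = (LINT u:{0..1}|lborel. \<phi> u)"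
    using assms(1) by (simp add: integral_density set_lebesgue_integral_def)
  also have "\<dots> = integral {0..1} \<phi>"
    by (intro set_borel_integral_eq_integral borel_integrable_atLeastAtMost' assms)
  finally show ?thesis .
qed

lemma nn_integral_unit_uniform_powr:
  assumes "a > 0"
  shows "(\<integral>\<^sup>+u. ennreal (u powr a) \<partial>unit_uniform) = ennreal (1 / (a + 1))"
proof -
  have "(\<integral>\<^sup>+u. ennreal (u powr a) \<partial>unit_uniform)
      = (\<integral>\<^sup>+u. ennreal (u powr a) * indicator {0..1} u \<partial>lborel)"
    by (subst nn_integral_uniform_measure) (auto simp: divide_ennreal_def)
  also have "\<dots> = (\<integral>\<^sup>+u. ennreal (indicator {0..1} u * u powr a) \<partial>lborel)"
    by (intro nn_integral_cong) (auto split: split_indicator)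
  also have "\<dots> = ennreal (1 powr (a + 1) / (a + 1))"
    using assms by (intro nn_integral_has_integral_lebesgue has_integral_powr_from_0) auto
  finally show ?thesis by simp
qed

lemma integrable_C11:
  assumes \<mu>: "real_distribution \<mu>" "integrable \<mu> (\<lambda>x. x)" and h: "C11 a b h h'"
  shows "integrable \<mu> h"
proof -
  interpret \<mu>: real_distribution \<mu> by (rule \<mu>)
  have [measurable]: "h \<in> borel_measurable borel"
    using C11D(4)[OF h] by (rule borel_measurable_continuous_onI)
  have "integrable \<mu> (\<lambda>x. \<bar>h 0\<bar> + a * \<bar>x\<bar>)"
    using \<mu>(2) by auto
  then show ?thesis
  proof (rule Bochner_Integration.integrable_bound)
    have "\<bar>h x\<bar> \<le> \<bar>h 0\<bar> + a * \<bar>x\<bar>" for x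
      using C11_lipschitz[OF h, of x 0] by simp
    then show "AE x in \<mu>. norm (h x) \<le> norm (\<bar>h 0\<bar> + a * \<bar>x\<bar>)"
      by (auto intro: order_trans[OF _ abs_ge_self])
  qed simp
qed

context
  fixes \<theta> :: real
  assumes \<theta>: "\<theta> > 0"
begin

abbreviation dickman_map :: "real \<times> real \<Rightarrow> real" where
  "dickman_map \<equiv> \<lambda>(w, u). u powr (1 / \<theta>) * (w + 1)"

text \<open>The distributional equation integrated against a test function, with the
uniform variable integrated out first by Fubini. Integrability passes from \<open>g\<close> to its transition, so
the step can be iterated.\<close>

lemma dickman_law_stationary:
  assumes \<mu>: "is_dickman_law \<theta> \<mu>" and g: "continuous_on UNIV g" "integrable \<mu> g"
  shows "integrable \<mu> (transition \<theta> g)" "(LINT x|\<mu>. transition \<theta> g x) = (LINT x|\<mu>. g x)"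
proof -
  interpret \<mu>: real_distribution \<mu> using \<mu> by (simp add: is_dickman_law_def)
  interpret U: prob_space unit_uniform by (rule prob_space_unit_uniform)
  interpret \<mu>U: pair_prob_space \<mu> unit_uniform ..
  have fixpoint: "\<mu> = distr (\<mu> \<Otimes>\<^sub>M unit_uniform) borel dickman_map"
    using \<mu> by (simp add: is_dickman_law_def)
  have meas [measurable]: "dickman_map \<in> borel_measurable (\<mu> \<Otimes>\<^sub>M unit_uniform)"
    by measurable
  have g_meas [measurable]: "g \<in> borel_measurable borel"
    using g(1) by (rule borel_measurable_continuous_onI)
  have int: "integrable (\<mu> \<Otimes>\<^sub>M unit_uniform) (\<lambda>z. g (dickman_map z))"
    using g(2) by (subst (asm) fixpoint) (simp add: integrable_distr_eq)
  have inner: "(LINT u|unit_uniform. g (dickman_map (w, u))) = transition \<theta> g w" for w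
    unfolding transition_def dilation_average_def prod.case
    by (intro integral_unit_uniform continuous_on_dilation[OF \<theta> g(1)]) measurable
  show "integrable \<mu> (transition \<theta> g)"
    using \<mu>U.integrable_fst'[OF int] by (simp only: inner)
  have "(LINT x|\<mu>. g x) = (LINT z|(\<mu> \<Otimes>\<^sub>M unit_uniform). g (dickman_map z))"
    by (subst fixpoint) (simp add: integral_distr)
  then show "(LINT x|\<mu>. transition \<theta> g x) = (LINT x|\<mu>. g x)"
    using \<mu>U.integral_fst'[OF int] by (simp only: inner)
qed

lemma dickman_law_stationary_funpow:
  assumes \<mu>: "is_dickman_law \<theta> \<mu>" and h: "C11 a b h h'" "integrable \<mu> h"
  shows "integrable \<mu> ((transition \<theta> ^^ n) h) \<and>
    (LINT x|\<mu>. (transition \<theta> ^^ n) h x) = (LINT x|\<mu>. h x)"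
proof (induction n)
  case (Suc n)
  have "continuous_on UNIV ((transition \<theta> ^^ n) h)"
    by (rule C11D(4)[OF C11_transition_funpow[OF \<theta> h(1)]])
  from dickman_law_stationary[OF \<mu> this] Suc show ?case by simp
qed (use h in simp)

text \<open>By stationarity the right-hand mean may be taken of the iterate instead of \<open>h\<close>; the iterate has
Lipschitz constant \<open>(\<theta> / (\<theta> + 1)) ^ n * a\<close>, hence differs little from its own mean.\<close>

lemma transition_funpow_mixing:
  assumes \<mu>: "is_dickman_law \<theta> \<mu>" "integrable \<mu> (\<lambda>x. x)" and h: "C11 a b h h'"
  shows "\<bar>(transition \<theta> ^^ n) h x - (LINT y|\<mu>. h y)\<bar>
    \<le> (\<theta> / (\<theta> + 1)) ^ n * (a * (LINT y|\<mu>. \<bar>x - y\<bar>))"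
proof -
  interpret \<mu>: real_distribution \<mu> using \<mu> by (simp add: is_dickman_law_def)
  let ?g = "(transition \<theta> ^^ n) h"
  have "integrable \<mu> h"
    by (rule integrable_C11[OF \<mu>.real_distribution_axioms \<mu>(2) h])
  note stat = dickman_law_stationary_funpow[OF \<mu>(1) h this, of n]
  have "?g x - (LINT y|\<mu>. h y) = (LINT y|\<mu>. ?g x - ?g y)"
    using stat by (simp add: \<mu>.prob_space del: \<mu>.space_eq_univ)
  then have "\<bar>?g x - (LINT y|\<mu>. h y)\<bar> \<le> (LINT y|\<mu>. \<bar>?g x - ?g y\<bar>)"
    by (simp only: integral_abs_bound)
  also have "\<dots> \<le> (LINT y|\<mu>. ((\<theta> / (\<theta> + 1)) ^ n * a) * \<bar>x - y\<bar>)"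
    using stat \<mu>(2) C11_lipschitz[OF C11_transition_funpow[OF \<theta> h]]
    by (intro integral_mono) auto
  finally show ?thesis by (simp add: mult_ac)
qed

lemma transition_funpow_limit:
  assumes \<mu>: "is_dickman_law \<theta> \<mu>" "integrable \<mu> (\<lambda>x. x)" and h: "C11 a b h h'"
  shows "summable (\<lambda>n. (transition \<theta> ^^ n) h x - (LINT y|\<mu>. h y))"
    and "(\<lambda>n. (transition \<theta> ^^ n) h x) \<longlonglongrightarrow> (LINT y|\<mu>. h y)"
proof -
  show sum: "summable (\<lambda>n. (transition \<theta> ^^ n) h x - (LINT y|\<mu>. h y))"
  proof (rule summable_comparison_test')
    show "summable (\<lambda>n. (\<theta> / (\<theta> + 1)) ^ n * (a * (LINT y|\<mu>. \<bar>x - y\<bar>)))"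
      using \<theta> by (intro summable_mult2 summable_geometric) auto
    show "norm ((transition \<theta> ^^ n) h x - (LINT y|\<mu>. h y))
      \<le> (\<theta> / (\<theta> + 1)) ^ n * (a * (LINT y|\<mu>. \<bar>x - y\<bar>))" for n
      using transition_funpow_mixing[OF \<mu> h] by simp
  qed
  show "(\<lambda>n. (transition \<theta> ^^ n) h x) \<longlonglongrightarrow> (LINT y|\<mu>. h y)"
    using summable_LIMSEQ_zero[OF sum] by (simp add: LIM_zero_iff)
qed

lemma transition_funpow_bounded:
  assumes h: "C11 a b h h'" and bound: "\<And>x. \<bar>h x\<bar> \<le> B"
  shows "\<bar>(transition \<theta> ^^ n) h x\<bar> \<le> B"
proof (induction n arbitrary: x)
  case (Suc n)
  let ?g = "(transition \<theta> ^^ n) h"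
  have "continuous_on UNIV ?g"
    by (rule C11D(4)[OF C11_transition_funpow[OF \<theta> h]])
  then have "norm (integral {0..1} (\<lambda>u. ?g (u powr (1 / \<theta>) * (x + 1)))) \<le> integral {0..1::real} (\<lambda>u. B)"
    using Suc by (intro integral_norm_bound_integral integrable_continuous_real
        continuous_on_dilation[OF \<theta>]) auto
  then show ?case
    by (simp add: transition_def[of \<theta> ?g] dilation_average_def)
qed (use bound in simp)

text \<open>The mean of \<open>h\<close> under the second law is that of every iterate. The iterates are uniformly bounded and
converge pointwise to the mean under the first law, so dominated convergence applies.\<close>

lemma dickman_laws_agree:
  assumes \<mu>: "is_dickman_law \<theta> \<mu>" "integrable \<mu> (\<lambda>x. x)" and \<nu>: "is_dickman_law \<theta> \<nu>"
    and h: "C11 a b h h'" "\<And>x. \<bar>h x\<bar> \<le> B"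
  shows "(LINT x|\<nu>. h x) = (LINT x|\<mu>. h x)"
proof -
  interpret \<nu>: real_distribution \<nu> using \<nu> by (simp add: is_dickman_law_def)
  have cont: "continuous_on UNIV ((transition \<theta> ^^ n) h)" for n
    by (rule C11D(4)[OF C11_transition_funpow[OF \<theta> h(1)]])
  have meas [measurable]: "(transition \<theta> ^^ n) h \<in> borel_measurable \<nu>" for n
    using borel_measurable_continuous_onI[OF cont] by simp
  have "integrable \<nu> h"
    using h(2) meas[of 0] by (intro \<nu>.integrable_const_bound[of _ B]) auto
  then have "(\<lambda>n. LINT x|\<nu>. (transition \<theta> ^^ n) h x) = (\<lambda>n. LINT x|\<nu>. h x)"
    using dickman_law_stationary_funpow[OF \<nu> h(1)] by auto
  moreover have "(\<lambda>n. LINT x|\<nu>. (transition \<theta> ^^ n) h x) \<longlonglongrightarrow> (LINT x|\<nu>. (LINT y|\<mu>. h y))"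
    using transition_funpow_limit(2)[OF \<mu> h(1)] transition_funpow_bounded[OF h]
    by (intro integral_dominated_convergence[where w = "\<lambda>_. B"]) auto
  ultimately have "(\<lambda>n. LINT x|\<nu>. h x) \<longlonglongrightarrow> (LINT y|\<mu>. h y)"
    by (simp add: \<nu>.prob_space del: \<nu>.space_eq_univ)
  then show ?thesis
    by (simp add: LIMSEQ_const_iff)
qed

lemma dickman_law_unique:
  assumes \<mu>: "is_dickman_law \<theta> \<mu>" "integrable \<mu> (\<lambda>x. x)" and \<nu>: "is_dickman_law \<theta> \<nu>"
  shows "\<nu> = \<mu>"
proof (rule Levy_uniqueness)
  show \<mu>': "real_distribution \<mu>" and \<nu>': "real_distribution \<nu>"
    using \<mu> \<nu> by (auto simp: is_dickman_law_def)
  have char: "char M t = Complex (LINT x|M. cos (t * x)) (LINT x|M. sin (t * x))"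
    if "real_distribution M" for M t
  proof -
    interpret M: real_distribution M by (rule that)
    have int: "integrable M (\<lambda>x. iexp (t * x))"
      by (rule M.integrable_iexp) auto
    have "Re (char M t) = (LINT x|M. cos (t * x))" "Im (char M t) = (LINT x|M. sin (t * x))"
      unfolding char_def using integral_Re[OF int] integral_Im[OF int]
      by (simp_all add: Re_exp Im_exp)
    then show ?thesis by (simp add: complex_eq_iff)
  qed
  show "char \<nu> = char \<mu>"
  proof
    show "char \<nu> t = char \<mu> t" for t
      unfolding char[OF \<mu>'] char[OF \<nu>']
      using dickman_laws_agree[OF \<mu> \<nu> C11_sin_cos(1)[of t], of 1]
        dickman_laws_agree[OF \<mu> \<nu> C11_sin_cos(2)[of t], of 1] by simp
  qed
qed

section \<open>Existence of the Dickman law\<close>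

text \<open>For independent uniform variables \<open>\<omega> 0, \<omega> 1, \<dots>\<close> the law is that of the sum of the products
\<open>p (n + 1)\<close>, where \<open>p n\<close> multiplies the first \<open>n\<close> of the factors \<open>\<omega> i powr (1 / \<theta>)\<close>. The products have
means \<open>\<rho> ^ (n + 1)\<close>, so the sum is almost surely finite and has a mean. Pulling out the first factor
leaves \<open>1\<close> plus the same sum for the shifted sequence, and prepending an independent uniform
variable to such a sequence reproduces its law.\<close>

lemma dickman_law_exists:
  obtains \<mu> where "is_dickman_law \<theta> \<mu>" "integrable \<mu> (\<lambda>x. x)"
proof -
  interpret U: prob_space unit_uniform by (rule prob_space_unit_uniform)
  interpret seq: sequence_space unit_uniform ..
  let ?S = "seq.S"
  interpret US: pair_prob_space unit_uniform ?S ..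
  interpret SU: pair_prob_space ?S unit_uniform ..
  let ?s = "\<lambda>u::real. u powr (1 / \<theta>)"
  define p where "p n \<omega> = (\<Prod>i<n. ?s (\<omega> i))" for n and \<omega> :: "nat \<Rightarrow> real"
  define W where "W \<omega> = (\<Sum>n. p (Suc n) \<omega>)" for \<omega>
  define \<rho> where "\<rho> = \<theta> / (\<theta> + 1)"
  have \<rho>: "0 \<le> \<rho>" "\<rho> < 1" using \<theta> by (auto simp: \<rho>_def)
  have p_nonneg: "0 \<le> p n \<omega>" for n \<omega>
    unfolding p_def by (intro prod_nonneg) auto
  have p_shift: "p (Suc n) (case_nat u \<omega>) = ?s u * p n \<omega>" for n u \<omega>
    unfolding p_def prod.lessThan_Suc_shift by simp
  have [measurable]: "p n \<in> borel_measurable ?S" for n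
    unfolding p_def by measurable
  have [measurable]: "W \<in> borel_measurable ?S"
    unfolding W_def by measurable
  have mean_p: "(\<integral>\<^sup>+\<omega>. ennreal (p n \<omega>) \<partial>?S) = ennreal (\<rho> ^ n)" for n
  proof (induction n)
    case 0
    show ?case by (simp add: p_def seq.P.emeasure_space_1)
  next
    case (Suc n)
    have "(\<integral>\<^sup>+\<omega>. ennreal (p (Suc n) \<omega>) \<partial>?S)
        = (\<integral>\<^sup>+z. ennreal (p (Suc n) (case_nat (fst z) (snd z))) \<partial>(unit_uniform \<Otimes>\<^sub>M ?S))"
      by (subst seq.PiM_iter[symmetric], subst nn_integral_distr) (auto simp: case_prod_unfold)
    also have "\<dots> = (\<integral>\<^sup>+u. \<integral>\<^sup>+\<omega>. ennreal (?s u) * ennreal (p n \<omega>) \<partial>?S \<partial>unit_uniform)"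
      by (subst seq.P.nn_integral_fst[symmetric]) (simp_all add: p_shift ennreal_mult' p_nonneg)
    also have "\<dots> = ennreal (1 / (1 / \<theta> + 1)) * ennreal (\<rho> ^ n)"
      using \<theta> by (simp add: nn_integral_cmult nn_integral_multc Suc nn_integral_unit_uniform_powr)
    also have "\<dots> = ennreal (\<rho> ^ Suc n)"
      using \<theta> \<rho> by (simp add: \<rho>_def field_simps flip: ennreal_mult')
    finally show ?case .
  qed
  have total: "(\<integral>\<^sup>+\<omega>. (\<Sum>n. ennreal (p (Suc n) \<omega>)) \<partial>?S) = ennreal (\<Sum>n. \<rho> ^ Suc n)"
    using \<rho> by (subst nn_integral_suminf)
      (simp_all only: mean_p, auto intro!: suminf_ennreal2 summable_mult summable_geometric)
  have total_finite: "AE \<omega> in ?S. (\<Sum>n. ennreal (p (Suc n) \<omega>)) \<noteq> \<infinity>"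
    by (rule nn_integral_PInf_AE) (auto simp: total)
  then have summable: "AE \<omega> in ?S. summable (\<lambda>n. p (Suc n) \<omega>)"
    by eventually_elim (auto intro!: summable_suminf_not_top p_nonneg)
  then have W_nonneg: "AE \<omega> in ?S. 0 \<le> W \<omega>"
    unfolding W_def by eventually_elim (auto intro!: suminf_nonneg p_nonneg)
  have W_int: "integrable ?S W"
  proof (rule integrableI_nn_integral_finite)
    have "(\<integral>\<^sup>+\<omega>. ennreal (W \<omega>) \<partial>?S) = (\<integral>\<^sup>+\<omega>. (\<Sum>n. ennreal (p (Suc n) \<omega>)) \<partial>?S)"
      using summable unfolding W_def
      by (intro nn_integral_cong_AE, eventually_elim) (simp add: suminf_ennreal2 p_nonneg)
    then show "(\<integral>\<^sup>+\<omega>. ennreal (W \<omega>) \<partial>?S) = ennreal (\<Sum>n. \<rho> ^ Suc n)"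
      by (simp add: total)
  qed (use W_nonneg in auto)
  have W_shift: "AE z in unit_uniform \<Otimes>\<^sub>M ?S. W (case_nat (fst z) (snd z)) = ?s (fst z) * (W (snd z) + 1)"
  proof -
    have "AE z in unit_uniform \<Otimes>\<^sub>M ?S. (\<Sum>n. ennreal (p (Suc n) (snd z))) \<noteq> \<infinity>"
    proof (rule US.AE_pair_measure)
      show "{z \<in> space (unit_uniform \<Otimes>\<^sub>M ?S). (\<Sum>n. ennreal (p (Suc n) (snd z))) \<noteq> \<infinity>}
          \<in> sets (unit_uniform \<Otimes>\<^sub>M ?S)"
        by measurable
    qed (use total_finite in simp)
    then show ?thesis
    proof eventually_elim
      fix z :: "real \<times> (nat \<Rightarrow> real)"
      assume "(\<Sum>n. ennreal (p (Suc n) (snd z))) \<noteq> \<infinity>"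
      then have "summable (\<lambda>n. p (Suc n) (snd z))"
        by (intro summable_suminf_not_top p_nonneg) simp
      then have s0: "summable (\<lambda>n. p n (snd z))"
        by (rule iffD1[OF summable_Suc_iff])
      have "W (case_nat (fst z) (snd z)) = ?s (fst z) * (\<Sum>n. p n (snd z))"
        unfolding W_def p_shift by (rule suminf_mult[OF s0])
      also have "(\<Sum>n. p n (snd z)) = W (snd z) + 1"
        using suminf_split_head[OF s0] by (simp add: W_def p_def)
      finally show "W (case_nat (fst z) (snd z)) = ?s (fst z) * (W (snd z) + 1)" .
    qed
  qed
  define \<mu> where "\<mu> = distr ?S borel W"
  have "distr (\<mu> \<Otimes>\<^sub>M unit_uniform) borel dickman_map = \<mu>"
  proof -
    have id: "distr unit_uniform unit_uniform (\<lambda>x. x) = unit_uniform"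
      by (rule distr_id)
    have "\<mu> \<Otimes>\<^sub>M unit_uniform = distr ?S borel W \<Otimes>\<^sub>M distr unit_uniform unit_uniform (\<lambda>x. x)"
      unfolding id \<mu>_def ..
    also have "\<dots> = distr (?S \<Otimes>\<^sub>M unit_uniform) (borel \<Otimes>\<^sub>M unit_uniform) (\<lambda>(\<omega>, u). (W \<omega>, u))"
      by (rule pair_measure_distr) (auto simp: id U.sigma_finite_measure_axioms)
    finally have "distr (\<mu> \<Otimes>\<^sub>M unit_uniform) borel dickman_map
        = distr (?S \<Otimes>\<^sub>M unit_uniform) borel (\<lambda>z. ?s (snd z) * (W (fst z) + 1))"
      by (simp add: distr_distr comp_def case_prod_unfold)
    also have "\<dots> = distr (unit_uniform \<Otimes>\<^sub>M ?S) borel (\<lambda>z. ?s (fst z) * (W (snd z) + 1))"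
      by (subst SU.distr_pair_swap) (simp add: distr_distr comp_def case_prod_unfold)
    also have "\<dots> = distr (unit_uniform \<Otimes>\<^sub>M ?S) borel (\<lambda>z. W (case_nat (fst z) (snd z)))"
      using W_shift by (intro distr_cong_AE) (auto elim!: eventually_mono)
    also have "\<dots> = distr (distr (unit_uniform \<Otimes>\<^sub>M ?S) ?S (\<lambda>(u, \<omega>). case_nat u \<omega>)) borel W"
      by (simp add: distr_distr comp_def case_prod_unfold)
    also have "\<dots> = \<mu>"
      unfolding seq.PiM_iter \<mu>_def ..
    finally show ?thesis .
  qed
  moreover have "real_distribution \<mu>"
    unfolding \<mu>_def by (rule seq.P.real_distribution_distr) measurable
  moreover have "AE w in \<mu>. 0 \<le> w"
    unfolding \<mu>_def using W_nonneg by (subst AE_distr_iff) simp_all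
  moreover have "integrable \<mu> (\<lambda>x. x)"
    using W_int by (simp add: \<mu>_def integrable_distr_eq)
  ultimately show ?thesis
    by (intro that[of \<mu>]) (simp_all only: is_dickman_law_def simp_thms)
qed

lemma dickman_is_dickman_law: "is_dickman_law \<theta> (dickman \<theta>)" "integrable (dickman \<theta>) (\<lambda>x. x)"
proof -
  obtain \<mu> where \<mu>: "is_dickman_law \<theta> \<mu>" "integrable \<mu> (\<lambda>x. x)"
    by (rule dickman_law_exists)
  then have "dickman \<theta> = \<mu>"
    unfolding dickman_def using dickman_law_unique by (intro the_equality) auto
  then show "is_dickman_law \<theta> (dickman \<theta>)" "integrable (dickman \<theta>) (\<lambda>x. x)"
    using \<mu> by auto
qed

end

section \<open>Passing between the half-line and the line\<close>

lemma lipschitz_imp_abs_derivative_le: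
  fixes f :: "real \<Rightarrow> real"
  assumes lip: "L-lipschitz_on S f" and f: "(f has_real_derivative D) (at x within S)"
    and x: "x \<in> S" "at x within S \<noteq> bot"
  shows "\<bar>D\<bar> \<le> L"
proof (rule tendsto_upperbound)
  show "((\<lambda>y. \<bar>(f y - f x) / (y - x)\<bar>) \<longlongrightarrow> \<bar>D\<bar>) (at x within S)"
    using f by (intro tendsto_rabs) (simp add: has_field_derivative_iff)
  have "\<bar>(f y - f x) / (y - x)\<bar> \<le> L" if "y \<in> S" "y \<noteq> x" for y
    using lipschitz_onD[OF lip that(1) x(1)] that(2) by (simp add: dist_real_def divide_simps)
  then show "\<forall>\<^sub>F y in at x within S. \<bar>(f y - f x) / (y - x)\<bar> \<le> L"
    by (auto simp: eventually_at_filter)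
qed (rule x(2))

lemma at_within_atLeast_0_neq_bot: "0 \<le> x \<Longrightarrow> at x within {0..} \<noteq> (bot :: real filter)"
  using islimpt_subset[of x "{x..x + 1}" "{0..}"]
  by (auto simp: islimpt_Icc trivial_limit_within)

lemma C11_imp_hderiv: "C11 \<alpha> \<beta> f f' \<Longrightarrow> 0 \<le> x \<Longrightarrow> hderiv f x = f' x"
  by (rule hderiv_eqI[OF has_field_derivative_at_within[OF C11D(1)]])

lemma C11_imp_H_class:
  assumes f: "C11 \<alpha> \<beta> f f'"
  shows "f \<in> H_class \<alpha> \<beta>"
  unfolding H_class_def
proof (intro CollectI conjI)
  show "f differentiable_on {0..}"
    using C11D(1)[OF f] unfolding differentiable_on_def
    by (meson differentiable_at_withinI real_differentiable_def)
  show "\<alpha>-lipschitz_on {0..} f"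
    using C11_lipschitz[OF f] C11D(2)[OF f, of 0]
    by (intro lipschitz_onI) (auto simp: dist_real_def)
  show "\<beta>-lipschitz_on {0..} (hderiv f)"
  proof (rule lipschitz_on_transform)
    show "\<beta>-lipschitz_on {0..} f'"
      using C11D(3)[OF f] by (rule lipschitz_on_subset) simp
  qed (simp add: C11_imp_hderiv[OF f])
qed

text \<open>Continuing \<open>h\<close> to the negative half-line by its tangent at \<open>0\<close> keeps the derivative continuous and
adds no new slopes, so both constants survive.\<close>

lemma H_class_extend_C11:
  assumes h: "h \<in> H_class \<alpha> \<beta>"
  obtains H H' where "C11 \<alpha> \<beta> H H'" "\<And>x. 0 \<le> x \<Longrightarrow> H x = h x"
proof -
  define H where "H x = (if x \<in> {0..} then h x else h 0 + hderiv h 0 * x)" for x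
  define H' where "H' x = hderiv h (max 0 x)" for x
  have lip: "\<alpha>-lipschitz_on {0..} h" and lip': "\<beta>-lipschitz_on {0..} (hderiv h)"
    using h by (auto simp: H_class_def)
  have deriv: "(h has_real_derivative hderiv h x) (at x within {0..})" if "0 \<le> x" for x
  proof -
    have "h differentiable (at x within {0..})"
      using h that by (auto simp: H_class_def differentiable_on_def)
    then obtain D where "(h has_real_derivative D) (at x within {0..})"
      by (auto simp: real_differentiable_def)
    then show ?thesis
      using hderiv_eqI that by blast
  qed
  have "C11 \<alpha> \<beta> H H'"
    unfolding C11_def
  proof (intro conjI allI)
    show "(H has_real_derivative H' x) (at x)" for x
    proof -
      have "(H has_derivative (if x \<in> {0..} then (*) (hderiv h x) else (*) (hderiv h 0)))
          (at x within {0..} \<union> {..<0})"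
        unfolding H_def[abs_def]
      proof (rule has_derivative_If_within_closures)
        assume "x \<in> {0..} \<union> closure {0..} \<inter> closure {..<0}"
        then show "(h has_derivative (*) (hderiv h x))
            (at x within {0..} \<union> closure {0..} \<inter> closure {..<0})"
          using deriv[of x] by (auto simp: has_field_derivative_def insert_absorb)
      qed (auto intro!: derivative_eq_intros)
      moreover have "{0..} \<union> {..<0} = (UNIV :: real set)"
        by auto
      ultimately show ?thesis
        by (auto simp: has_field_derivative_def H'_def max_def split: if_splits)
    qed
    show "\<bar>H' x\<bar> \<le> \<alpha>" for x
      unfolding H'_def
      by (intro lipschitz_imp_abs_derivative_le[OF lip deriv]) (auto simp: at_within_atLeast_0_neq_bot)
    show "\<beta>-lipschitz_on UNIV H'"
    proof (rule lipschitz_onI)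
      show \<beta>: "0 \<le> \<beta>" using lip' by (rule lipschitz_on_nonneg)
      show "dist (H' x) (H' y) \<le> \<beta> * dist x y" for x y
      proof -
        have "dist (H' x) (H' y) \<le> \<beta> * dist (max 0 x) (max 0 y)"
          unfolding H'_def by (rule lipschitz_onD[OF lip']) auto
        also have "\<dots> \<le> \<beta> * dist x y"
          using \<beta> by (intro mult_left_mono) (auto simp: dist_real_def)
        finally show ?thesis .
      qed
    qed
  qed
  then show ?thesis
    by (rule that) (simp add: H_def)
qed

text \<open>The law does not charge the negative half-line, so any continuous extension of \<open>h\<close> has the same mean.\<close>

lemma dickman_expectation_eq:
  assumes "\<theta> > 0" "continuous_on UNIV H" "\<And>x. 0 \<le> x \<Longrightarrow> H x = h x"
  shows "dickman_expectation \<theta> h = (LINT x|dickman \<theta>. H x)"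
proof -
  have D: "is_dickman_law \<theta> (dickman \<theta>)"
    by (rule dickman_is_dickman_law[OF assms(1)])
  interpret real_distribution "dickman \<theta>"
    using D by (simp add: is_dickman_law_def)
  have [measurable]: "H \<in> borel_measurable borel"
    using assms(2) by (rule borel_measurable_continuous_onI)
  have "dickman_expectation \<theta> h = (LINT x|dickman \<theta>. indicator {0..} x *\<^sub>R H x)"
    unfolding dickman_expectation_def set_lebesgue_integral_def
    by (intro Bochner_Integration.integral_cong) (auto split: split_indicator simp: assms(3))
  also have "\<dots> = (LINT x|dickman \<theta>. H x)"
    using D by (intro integral_cong_AE) (auto simp: is_dickman_law_def elim: eventually_mono)
  finally show ?thesis .
qed

section \<open>The solution on the half-line\<close>

text \<open>Away from \<open>0\<close> the equation itself expresses \<open>f'\<close> through differentiable functions.\<close>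

lemma Stein_solution_differentiable_deriv:
  assumes \<theta>: "\<theta> > 0" and f: "C11 a b f f'" and H: "C11 a' b' H H'"
    and eq: "\<And>x. x / \<theta> * f' x + f x - f (x + 1) = H x - c" and x: "0 < x"
  obtains D where "(f' has_real_derivative D) (at x)"
proof -
  have f'_eq: "\<theta> / y * (H y - c - f y + f (y + 1)) = f' y" if "0 < y" for y
    using eq[of y] that \<theta> by (simp add: field_simps)
  have "((\<lambda>y. \<theta> / y * (H y - c - f y + f (y + 1))) has_real_derivative
      - (\<theta> / x\<^sup>2) * (H x - c - f x + f (x + 1)) + (H' x - f' x + f' (x + 1)) * (\<theta> / x)) (at x)"
    using x C11D(1)[OF H] C11D(1)[OF f] C11D(1)[OF C11_shift[OF f]]
    by (auto intro!: derivative_eq_intros simp: power2_eq_square diff_divide_distrib)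
  then have "(f' has_real_derivative
      - (\<theta> / x\<^sup>2) * (H x - c - f x + f (x + 1)) + (H' x - f' x + f' (x + 1)) * (\<theta> / x)) (at x)"
    by (rule has_field_derivative_transform_within_open[of _ _ _ "{0<..}"]) (use x f'_eq in auto)
  then show ?thesis by (rule that)
qed

theorem theorem4p9:
  fixes \<theta> :: real and h :: "real \<Rightarrow> real"
  assumes "\<theta> > 0" and "h \<in> H_class 1 1"
  shows "\<exists>f \<in> H_class \<theta> (\<theta> / 2).
    (\<forall>x\<ge>0. x / \<theta> * hderiv f x + f x - f (x + 1) = h x - dickman_expectation \<theta> h) \<and>
    (SUP x\<in>{0<..}. ereal \<bar>hderiv f x\<bar>) \<le> ereal \<theta> \<and>
    hderiv f differentiable_on {0<..} \<and>
    (SUP x\<in>{0<..}. ereal \<bar>deriv (hderiv f) x\<bar>) \<le> ereal (\<theta> / 2)"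
proof -
  obtain H H' where H: "C11 1 1 H H'" and Hh: "\<And>x. 0 \<le> x \<Longrightarrow> H x = h x"
    using H_class_extend_C11[OF assms(2)] by blast
  define c where "c = (LINT x|dickman \<theta>. H x)"
  have c: "dickman_expectation \<theta> h = c"
    unfolding c_def by (rule dickman_expectation_eq[OF assms(1) C11D(4)[OF H] Hh])
  obtain f f' where f: "C11 \<theta> (\<theta> / 2) f f'"
    and eq: "\<And>x. x / \<theta> * f' x + f x - f (x + 1) = H x - c"
    using Stein_equation_C11[OF assms(1) H
        transition_funpow_limit[OF assms(1) dickman_is_dickman_law[OF assms(1)] H]]
    unfolding c_def by blast
  have second: "\<exists>D. (hderiv f has_real_derivative D) (at x) \<and> \<bar>D\<bar> \<le> \<theta> / 2" if "0 < x" for x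
  proof -
    obtain D where D: "(f' has_real_derivative D) (at x)"
      using Stein_solution_differentiable_deriv[OF assms(1) f H eq \<open>0 < x\<close>] .
    have "\<bar>D\<bar> \<le> \<theta> / 2"
      using lipschitz_imp_abs_derivative_le[OF C11D(3)[OF f] D] by simp
    moreover have "(hderiv f has_real_derivative D) (at x)"
      using D by (rule has_field_derivative_transform_within_open[of _ _ _ "{0<..}"])
        (use that C11_imp_hderiv[OF f] in auto)
    ultimately show ?thesis by blast
  qed
  show ?thesis
  proof (intro bexI[of _ f] conjI allI impI)
    show "x / \<theta> * hderiv f x + f x - f (x + 1) = h x - dickman_expectation \<theta> h" if "x \<ge> 0" for x
      using eq[of x] that by (simp add: C11_imp_hderiv[OF f] Hh c)
    show "(SUP x\<in>{0<..}. ereal \<bar>hderiv f x\<bar>) \<le> ereal \<theta>"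
      using C11D(2)[OF f] by (intro SUP_least) (simp add: C11_imp_hderiv[OF f])
    show "hderiv f differentiable_on {0<..}"
      unfolding differentiable_on_def using second
      by (meson differentiable_at_withinI greaterThan_iff real_differentiable_def)
    show "(SUP x\<in>{0<..}. ereal \<bar>deriv (hderiv f) x\<bar>) \<le> ereal (\<theta> / 2)"
      using second by (intro SUP_least) (auto dest!: DERIV_imp_deriv)
    show "f \<in> H_class \<theta> (\<theta> / 2)"
      by (rule C11_imp_H_class[OF f])
  qed
qed

end
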